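(* Let $G$ be a finitely generated group, fix a finite symmetric generating set, let $B_n$ denote the ball of radius $n$ about the identity in the associated word metric, and suppose there are an integer $d\ge 0$ and a constant $C>0$ with $|B_n|\le C n^d$ for all $n\ge 1$. Then every continuous action $G\curvearrowright X$ on a compact metric space $X$ has weak $2^{d}$-comparison: for all open sets $A,B\subseteq X$ with $\overline{D}(A)<\underline{D}(B)$ we have $A\prec_{2^d}B$.
   Context: Lower and upper densities of $A\subseteq X$: $\underline{D}(A)=\sup_{F\Subset G}\inf_{x\in X}\frac{1}{|F|}\sum_{s\in F}1_A(sx)$ and $\overline{D}(A)=\inf_{F\Subset G}\sup_{x\in X}\frac{1}{|F|}\sum_{s\in F}1_A(sx)$, with $F$ ranging over nonempty finite subsets of $G$. For $A,B\subseteq X$ and integer $k\ge0$, $A\prec_k B$ means that for every closed $C\subseteq A$ there are a finite open cover $\mathscr U$ of $C$, an element $s_U\in G$ for each $U\in\mathscr U$, and a partition $\mathscr U=\mathscr U_0\sqcup\dots\sqcup\mathscr U_k$ such that for each $i$ the sets $s_UU$, $U\in\mathscr U_i$, are pairwise disjoint and contained in $B$. *)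

theory Defs
  imports "HOL-Analysis.Analysis"
begin

text \<open>The group G is a type of class group_add (written additively, not necessarily
commutative); the compact metric space X is a type of class metric_space whose
universe is compact. An action is a map act :: 'g => 'x => 'x.\<close>

definition group_action :: "('g::group_add \<Rightarrow> 'x \<Rightarrow> 'x) \<Rightarrow> bool" where
  "group_action act \<longleftrightarrow> (\<forall>x. act 0 x = x) \<and> (\<forall>g h x. act (g + h) x = act g (act h x))"

definition continuous_action :: "('g::group_add \<Rightarrow> 'x::topological_space \<Rightarrow> 'x) \<Rightarrow> bool" where
  "continuous_action act \<longleftrightarrow> group_action act \<and> (\<forall>g. continuous_on UNIV (act g))"

definition word_ball :: "'g::group_add set \<Rightarrow> nat \<Rightarrow> 'g set" where
  "word_ball S n = {g. \<exists>ws. set ws \<subseteq> S \<and> length ws \<le> n \<and> sum_list ws = g}"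

definition finite_symmetric_generating_set :: "'g::group_add set \<Rightarrow> bool" where
  "finite_symmetric_generating_set S \<longleftrightarrow> finite S \<and> (\<forall>s\<in>S. - s \<in> S) \<and>
     (\<forall>g. \<exists>ws. set ws \<subseteq> S \<and> sum_list ws = g)"

definition orbit_avg :: "('g \<Rightarrow> 'x \<Rightarrow> 'x) \<Rightarrow> 'x set \<Rightarrow> 'g set \<Rightarrow> 'x \<Rightarrow> real" where
  "orbit_avg act A F x = (\<Sum>s\<in>F. indicator A (act s x)) / real (card F)"

definition lower_density :: "('g \<Rightarrow> 'x \<Rightarrow> 'x) \<Rightarrow> 'x set \<Rightarrow> real" where
  "lower_density act A = (SUP F\<in>{F. finite F \<and> F \<noteq> {}}. INF x. orbit_avg act A F x)"

definition upper_density :: "('g \<Rightarrow> 'x \<Rightarrow> 'x) \<Rightarrow> 'x set \<Rightarrow> real" where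
  "upper_density act A = (INF F\<in>{F. finite F \<and> F \<noteq> {}}. SUP x. orbit_avg act A F x)"

text \<open>A \<prec>_k B. The partition of the cover into U_0,...,U_k is given by an index map.\<close>
definition subequiv :: "('g \<Rightarrow> 'x::topological_space \<Rightarrow> 'x) \<Rightarrow> nat \<Rightarrow> 'x set \<Rightarrow> 'x set \<Rightarrow> bool" where
  "subequiv act k A B \<longleftrightarrow>
    (\<forall>C. closed C \<and> C \<subseteq> A \<longrightarrow>
      (\<exists>\<U> (s :: 'x set \<Rightarrow> 'g) (idx :: 'x set \<Rightarrow> nat).
         finite \<U> \<and> (\<forall>U\<in>\<U>. open U) \<and> C \<subseteq> \<Union>\<U> \<and>
         (\<forall>U\<in>\<U>. idx U \<le> k) \<and>
         (\<forall>U\<in>\<U>. act (s U) ` U \<subseteq> B) \<and>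
         (\<forall>U\<in>\<U>. \<forall>V\<in>\<U>. U \<noteq> V \<and> idx U = idx V \<longrightarrow>
             act (s U) ` U \<inter> act (s V) ` V = {})))"

end

(*
  Every point of A looks for a slot (y, c), where y is a point of B in its orbit and c is one of
  2^d + 1 colours. For each x there is a scale n, bounded independently of x, such that
  2^d + 1 times the number of points of B in the orbit ball O_n(x) exceeds the number of points
  of A in O_2n(x): otherwise the orbit balls, which have at most C n^d points, would grow too fast
  along a sequence of doubling radii. Orbit points are counted without multiplicity, so the action
  need not be free. Hence, if points claim slots greedily, x cannot find all slots in O_n(x)
  claimed by other points, provided that each point pays for at most one slot.

  Claims must be made on open sets, so on boundaries a point could block several slots at once. To
  prevent this, claims are continuous functions with values at most 1: step k raises the claim of x
  as far as the slot has room, damped by a cutoff that vanishes once the earlier claims of x exceed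
  a threshold. The thresholds decrease with k in such a way that a point is in the transitional
  range of at most one cutoff. Charging each blocked slot to the first substantial claim on it is
  then injective, and the sets where the claims exceed 1/2 form the cover.
*)
theory Submission
  imports Defs
begin

subsection \<open>Greedy claims with staggered thresholds\<close>

text \<open>The values decrease from 3/4 towards 1/2. Staying above 1/2 leaves a point of load at
  most 1/2 undamped; staying at most 3/4 lets one claim above 3/4 stop all later ones.
  \<open>cutoff k\<close> falls linearly from 1 to 0 between the thresholds of \<open>Suc k\<close>
  and \<open>k\<close>, so the transitional ranges of different steps meet at most in
  endpoints.\<close>

definition cutoff_threshold :: "nat \<Rightarrow> real" where
  "cutoff_threshold k = 1/2 + 1 / (real k + 4)"

definition cutoff :: "nat \<Rightarrow> real \<Rightarrow> real" where
  "cutoff k m = max 0 (min 1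
     ((cutoff_threshold k - m) / (cutoff_threshold k - cutoff_threshold (Suc k))))"

lemma cutoff_threshold_antimono: "j \<le> k \<Longrightarrow> cutoff_threshold k \<le> cutoff_threshold j"
  by (simp add: cutoff_threshold_def frac_le)

lemma cutoff_threshold_Suc_less: "cutoff_threshold (Suc k) < cutoff_threshold k"
  by (simp add: cutoff_threshold_def frac_less2)

lemma cutoff_threshold_bounds: "1/2 < cutoff_threshold k" "cutoff_threshold k \<le> 3/4"
  using cutoff_threshold_antimono[of 0 k] by (simp_all add: cutoff_threshold_def)

lemma cutoff_eq_1: "m \<le> cutoff_threshold (Suc k) \<Longrightarrow> cutoff k m = 1"
  using cutoff_threshold_Suc_less[of k] by (simp add: cutoff_def field_simps)

lemma cutoff_pos_imp: "0 < cutoff k m \<Longrightarrow> m < cutoff_threshold k"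
  using cutoff_threshold_Suc_less[of k]
  by (auto simp: cutoff_def less_max_iff_disj zero_less_divide_iff)

lemma continuous_on_cutoff [continuous_intros]:
  "continuous_on A f \<Longrightarrow> continuous_on A (\<lambda>x. cutoff k (f x))"
  using cutoff_threshold_Suc_less[of k] unfolding cutoff_def
  by (intro continuous_intros) auto

text \<open>At step \<open>k\<close> every point \<open>x\<close> bids for the slot of colour
  \<open>col k\<close> at \<open>act (s k) x\<close>. \<open>m\<^sub>0\<close> and \<open>b\<close>
  are the initial load and room: points where \<open>m\<^sub>0\<close> is 1 never make a positive
  claim, and slots where \<open>b\<close> is 0 never receive one.\<close>

locale greedy_matching =
  fixes act :: "'g::group_add \<Rightarrow> 'x::topological_space \<Rightarrow> 'x"
    and s :: "nat \<Rightarrow> 'g" and col :: "nat \<Rightarrow> nat"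
    and m\<^sub>0 b :: "'x \<Rightarrow> real"
  assumes action: "group_action act"
begin

lemma act_uminus [simp]: "act (- g) (act g x) = x" "act g (act (- g) x) = x"
  using action unfolding group_action_def by (metis add.left_inverse, metis add.right_inverse)

text \<open>Maximum and minimum are used instead of sums and differences, so that a lack of room can
  always be attributed to one single earlier claim (\<open>room_cases\<close>). The mutual recursion
  forces the claim of step \<open>k\<close> to be written out; it is named \<open>claim k\<close>
  below.\<close>

fun load :: "nat \<Rightarrow> 'x \<Rightarrow> real" and room :: "nat \<Rightarrow> nat \<Rightarrow> 'x \<Rightarrow> real" where
  "load 0 x = m\<^sub>0 x"
| "load (Suc k) x = max (load k x) (min (cutoff k (load k x)) (room k (col k) (act (s k) x)))"
| "room 0 c y = b y"
| "room (Suc k) c y = (if c = col k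
     then min (room k c y) (1 - min (cutoff k (load k (act (- s k) y))) (room k c y))
     else room k c y)"

definition claim :: "nat \<Rightarrow> 'x \<Rightarrow> real" where
  "claim k x = min (cutoff k (load k x)) (room k (col k) (act (s k) x))"

lemma load_Suc: "load (Suc k) x = max (load k x) (claim k x)"
  by (simp add: claim_def)

lemma room_Suc: "room (Suc k) c y =
    (if c = col k then min (room k c y) (1 - claim k (act (- s k) y)) else room k c y)"
  by (simp add: claim_def)

declare load.simps(2) [simp del] room.simps(2) [simp del]

lemma load_mono: "j \<le> k \<Longrightarrow> load j x \<le> load k x"
  by (induction k rule: dec_induct) (auto simp: load_Suc)

lemma claim_le_load: "j < k \<Longrightarrow> claim j x \<le> load k x"
  using load_mono[of "Suc j" k x] by (auto simp: load_Suc)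

lemma room_antimono: "j \<le> k \<Longrightarrow> room k c y \<le> room j c y"
  by (induction k rule: dec_induct) (auto simp: room_Suc)

lemma room_le: "j < k \<Longrightarrow> room k (col j) y \<le> 1 - claim j (act (- s j) y)"
  using room_antimono[of "Suc j" k "col j" y] by (auto simp: room_Suc)

lemma room_cases:
  assumes "room k c y \<le> t"
  shows "b y \<le> t \<or> (\<exists>j<k. col j = c \<and> 1 - t \<le> claim j (act (- s j) y))"
  using assms
proof (induction k)
  case (Suc k)
  then show ?case
    by (auto simp: room_Suc less_Suc_eq min_le_iff_disj split: if_splits)
qed simp

lemma continuous_load_room:
  assumes "continuous_action act" "continuous_on UNIV m\<^sub>0" "continuous_on UNIV b"
  shows "continuous_on UNIV (load k) \<and> (\<forall>c. continuous_on UNIV (room k c))"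
proof (induction k)
  case 0
  have "load 0 = m\<^sub>0" "room 0 c = b" for c by auto
  then show ?case using assms by simp
next
  case (Suc k)
  have "continuous_on UNIV (\<lambda>x. f (act g x))" if "continuous_on UNIV f" for f :: "'x \<Rightarrow> real" and g
    using that assms(1) continuous_on_compose2[of UNIV f UNIV "act g"]
    unfolding continuous_action_def by auto
  note c = this
  have l: "continuous_on UNIV (load k)" and r: "continuous_on UNIV (room k c)" for c
    using Suc by auto
  have cl: "continuous_on UNIV (claim k)"
    unfolding claim_def by (intro continuous_intros l c r)
  have "load (Suc k) = (\<lambda>x. max (load k x) (claim k x))"
    by (simp add: fun_eq_iff load_Suc)
  moreover have "room (Suc k) c = (if c = col k
      then \<lambda>y. min (room k c y) (1 - claim k (act (- s k) y)) else room k c)" for c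
    by (simp add: fun_eq_iff room_Suc)
  ultimately show ?case
    by (auto intro!: continuous_intros l c r cl)
qed

lemma continuous_claim:
  assumes "continuous_action act" "continuous_on UNIV m\<^sub>0" "continuous_on UNIV b"
  shows "continuous_on UNIV (claim k)"
proof -
  have l: "continuous_on UNIV (load k)" and r: "continuous_on UNIV (room k c)" for c
    using continuous_load_room[OF assms] by auto
  have "continuous_on UNIV (\<lambda>x. room k (col k) (act (s k) x))"
    using r assms(1) continuous_on_compose2[of UNIV "room k (col k)" UNIV "act (s k)"]
    unfolding continuous_action_def by auto
  then show ?thesis unfolding claim_def by (intro continuous_intros l)
qed

lemma claimed_target: "1/2 < claim k x \<Longrightarrow> 1/2 < b (act (s k) x)"
  using room_antimono[of 0 k "col k" "act (s k) x"] by (auto simp: claim_def)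

text \<open>Of two claims on one slot, the later is bounded by the room that the earlier leaves.
  They add up to at most 1, so they cannot both exceed 1/2.\<close>

lemma claimed_targets_disjoint:
  assumes "j \<noteq> k" "col j = col k"
  shows "act (s j) ` {x. 1/2 < claim j x} \<inter> act (s k) ` {x. 1/2 < claim k x} = {}"
proof -
  have "act (s j) x \<noteq> act (s k) x'"
    if "j < k" "col j = col k" "1/2 < claim j x" "1/2 < claim k x'" for j k x x'
  proof
    assume eq: "act (s j) x = act (s k) x'"
    have "claim k x' \<le> room k (col j) (act (s j) x)"
      using that(2) eq by (simp add: claim_def)
    also have "\<dots> \<le> 1 - claim j x"
      using room_le[OF that(1), of "act (s j) x"] by simp
    finally show False using that by simp
  qed
  from this[of j k] this[of k j] show ?thesis
    using assms by (cases j k rule: linorder_cases) (auto, metis+)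
qed

section \<open>Charging blocked slots to their owners\<close>

definition owner_step :: "nat \<Rightarrow> 'x \<Rightarrow> nat" where
  "owner_step c y = (LEAST j. col j = c \<and> 1/4 \<le> claim j (act (- s j) y))"

text \<open>The bound 1/4 is complementary to the largest threshold 3/4: the claims on the slot
  before the owner's are below 1/4, so a slot with initial room above 3/4 still has such room when
  its owner claims. This supplies the first premise of \<open>claim_at_most_once\<close>.\<close>

lemma owner_step:
  assumes "col k = c" "1/4 \<le> claim k (act (- s k) y)"
  defines "j \<equiv> owner_step c y"
  shows "j \<le> k" "col j = c" "1/4 \<le> claim j (act (- s j) y)"
    and "3/4 < b y \<Longrightarrow> 3/4 < room j c y"
proof -
  let ?P = "\<lambda>j. col j = c \<and> 1/4 \<le> claim j (act (- s j) y)"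
  have "?P k" using assms by simp
  then show "j \<le> k" and j: "col j = c" "1/4 \<le> claim j (act (- s j) y)"
    unfolding j_def owner_step_def using Least_le[of ?P] LeastI[of ?P] by auto
  show "3/4 < room j c y" if full: "3/4 < b y"
  proof (rule ccontr)
    assume "\<not> 3/4 < room j c y"
    then obtain i where "i < j" "?P i"
      using room_cases[of j c y "3/4"] full by auto
    then show False unfolding j_def owner_step_def using not_less_Least by blast
  qed
qed

text \<open>Staggering the thresholds is what makes a point pay for at most one slot: if its first
  claim is not above every threshold, then its load has already passed the threshold of
  every later step.\<close>

lemma claim_at_most_once:
  assumes "3/4 < room i (col i) (act (s i) z)" "1/4 \<le> claim i z" "1/4 \<le> claim j z"
  shows "j \<le> i"
proof (rule ccontr)
  assume "\<not> j \<le> i"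
  then have "i < j" by simp
  have "load j z < cutoff_threshold j"
    using assms(3) by (intro cutoff_pos_imp) (simp add: claim_def)
  moreover have "cutoff_threshold j \<le> cutoff_threshold (Suc i)"
    using \<open>i < j\<close> by (intro cutoff_threshold_antimono) simp
  moreover have "load i z \<le> load j z" "claim i z \<le> load j z"
    using \<open>i < j\<close> load_mono claim_le_load by auto
  moreover have "claim i z > 3/4" if "load i z \<le> cutoff_threshold (Suc i)"
    using cutoff_eq_1[OF that] assms(1) by (simp add: claim_def)
  ultimately show False using cutoff_threshold_bounds(2)[of j] by linarith
qed

text \<open>The map from slots to owners is injective: if two slots share an owner,
  \<open>claim_at_most_once\<close>, applied both ways, shows that they were claimed at the same
  step, and owner and step determine the slot.\<close>

lemma card_blocked_slots_le:
  fixes T :: "(nat \<times> 'x) set"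
  assumes full: "\<And>c y. (c, y) \<in> T \<Longrightarrow> 3/4 < b y"
    and blocked: "\<And>c y. (c, y) \<in> T \<Longrightarrow>
      \<exists>k. col k = c \<and> 1/4 \<le> claim k (act (- s k) y) \<and>
          (\<forall>j\<le>k. m\<^sub>0 (act (- s j) y) < 1 \<longrightarrow> act (- s j) y \<in> Z)"
    and "finite Z"
  shows "card T \<le> card Z"
proof -
  define j where "j = (\<lambda>(c, y). owner_step c y)"
  define owner where "owner = (\<lambda>t. act (- s (j t)) (snd t))"
  have j: "col (j t) = fst t" "1/4 \<le> claim (j t) (owner t)"
    "3/4 < room (j t) (col (j t)) (act (s (j t)) (owner t))" "owner t \<in> Z" if t_in: "t \<in> T" for t
  proof -
    obtain c y where t: "t = (c, y)" by force
    obtain k where k: "col k = c" "1/4 \<le> claim k (act (- s k) y)"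
        "\<forall>j\<le>k. m\<^sub>0 (act (- s j) y) < 1 \<longrightarrow> act (- s j) y \<in> Z"
      using blocked[of c y] t_in t by blast
    note o = owner_step[OF k(1,2)]
    show 1: "col (j t) = fst t" "1/4 \<le> claim (j t) (owner t)"
      "3/4 < room (j t) (col (j t)) (act (s (j t)) (owner t))"
      using o full t_in by (auto simp: t j_def owner_def)
    \<comment> \<open>A positive claim means that the cutoff has not vanished. This keeps the load
      below 3/4 and so rules out owners with \<open>m\<^sub>0\<close> equal to 1.\<close>
    have "load (j t) (owner t) < cutoff_threshold (j t)"
      using 1(2) by (intro cutoff_pos_imp) (simp add: claim_def)
    then have "m\<^sub>0 (owner t) < 1"
      using load_mono[of 0 "j t" "owner t"] cutoff_threshold_bounds(2)[of "j t"] by simp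
    then show "owner t \<in> Z"
      using k(3) o(1) by (simp add: t j_def owner_def)
  qed
  have "inj_on owner T"
  proof (rule inj_onI)
    fix t u assume tu: "t \<in> T" "u \<in> T" "owner t = owner u"
    then have "j t = j u"
      using claim_at_most_once[of "j t" "owner t" "j u"]
        claim_at_most_once[of "j u" "owner u" "j t"] j by (metis le_antisym)
    moreover from this have "snd t = snd u"
      using tu(3) unfolding owner_def by (metis act_uminus(2))
    ultimately show "t = u" using j(1) tu by (metis prod.collapse)
  qed
  moreover have "owner ` T \<subseteq> Z" using j(4) by auto
  ultimately show ?thesis using card_inj_on_le \<open>finite Z\<close> by blast
qed

text \<open>As long as no claim of \<open>x\<close> exceeds 1/2, its load stays below every
  threshold and its claims are undamped. A small claim can then only be due to a lack of
  room.\<close>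

lemma unclaimed_imp_blocked:
  assumes "m\<^sub>0 x \<le> 1/2" "\<And>j. j \<le> k \<Longrightarrow> claim j x \<le> 1/2" "3/4 < b (act (s k) x)"
  shows "\<exists>j<k. col j = col k \<and> 1/4 \<le> claim j (act (- s j) (act (s k) x))"
proof -
  have "load i x \<le> 1/2" if "i \<le> k" for i
    using that
  proof (induction i)
    case (Suc i)
    then show ?case using assms(2)[of i] by (simp add: load_Suc)
  qed (use assms(1) in simp)
  then have "cutoff k (load k x) = 1"
    using cutoff_threshold_bounds(1)[of "Suc k"] by (intro cutoff_eq_1) (meson order.trans less_imp_le order.refl)
  then have "room k (col k) (act (s k) x) \<le> 1/2"
    using assms(2)[of k] by (auto simp: claim_def min_le_iff_disj)
  then show ?thesis using room_cases[of k "col k" _ "3/4"] assms(3) by force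
qed

end

subsection \<open>Word balls, orbit averages and densities\<close>

lemma finite_word_ball: "finite S \<Longrightarrow> finite (word_ball S n)"
proof -
  assume "finite S"
  have "word_ball S n = sum_list ` {ws. set ws \<subseteq> S \<and> length ws \<le> n}"
    unfolding word_ball_def by auto
  then show ?thesis using finite_lists_length_le[OF \<open>finite S\<close>] by simp
qed

lemma word_ball_mono: "m \<le> n \<Longrightarrow> word_ball S m \<subseteq> word_ball S n"
  unfolding word_ball_def by auto

lemma zero_in_word_ball: "0 \<in> word_ball S n"
  unfolding word_ball_def by (auto intro: exI[of _ "[]"])

lemma word_ball_add:
  assumes "g \<in> word_ball S m" "h \<in> word_ball S n"
  shows "g + h \<in> word_ball S (m + n)"
proof -
  obtain v w where "set v \<subseteq> S" "length v \<le> m" "sum_list v = g"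
    "set w \<subseteq> S" "length w \<le> n" "sum_list w = h"
    using assms unfolding word_ball_def by auto
  then show ?thesis unfolding word_ball_def by (auto intro!: exI[of _ "v @ w"])
qed

lemma word_ball_uminus:
  assumes "\<And>s. s \<in> S \<Longrightarrow> - s \<in> S" "g \<in> word_ball S n"
  shows "- g \<in> word_ball S n"
proof -
  have "sum_list (rev (map uminus ws)) = - sum_list ws" for ws :: "'a list"
    by (induction ws) (auto simp: minus_add)
  moreover obtain w where "set w \<subseteq> S" "length w \<le> n" "sum_list w = g"
    using assms unfolding word_ball_def by auto
  ultimately show ?thesis
    unfolding word_ball_def using assms(1) by (fastforce intro!: exI[of _ "rev (map uminus w)"])
qed

lemma finite_subset_word_ball:
  assumes "finite_symmetric_generating_set S" "finite F"
  obtains r where "F \<subseteq> word_ball S r"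
proof -
  have "\<exists>n. g \<in> word_ball S n" for g
    using assms(1) unfolding finite_symmetric_generating_set_def word_ball_def by blast
  then obtain n where n: "\<And>g. g \<in> word_ball S (n g)" by metis
  have "F \<subseteq> word_ball S (Max (n ` F))"
  proof
    fix g assume "g \<in> F"
    then show "g \<in> word_ball S (Max (n ` F))"
      using n word_ball_mono[of "n g" "Max (n ` F)" S] assms(2) by auto
  qed
  then show thesis by (rule that)
qed

section \<open>Orbit averages and densities\<close>

lemma orbit_avg_eq_card:
  "finite F \<Longrightarrow> orbit_avg act A F x = real (card {s \<in> F. act s x \<in> A}) / real (card F)"
  unfolding orbit_avg_def
  by (simp add: indicator_def sum.If_cases Int_def)

lemma orbit_avg_bounds: "finite F \<Longrightarrow> 0 \<le> orbit_avg act A F x \<and> orbit_avg act A F x \<le> 1"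
  by (simp add: orbit_avg_eq_card divide_le_eq card_mono)

text \<open>A strict inequality between an infimum and a supremum is witnessed by single windows
  \<open>F\<close> and \<open>F'\<close>. Averages lie between 0 and 1, which gives the boundedness
  required for suprema and infima of reals.\<close>

lemma density_separation:
  assumes "upper_density act A < lower_density act B"
  obtains F F' \<alpha> \<gamma> where "finite F" "F \<noteq> {}" "finite F'" "F' \<noteq> {}" "\<alpha> < \<gamma>"
    "\<And>x. orbit_avg act A F x \<le> \<alpha>" "\<And>x. \<gamma> \<le> orbit_avg act B F' x"
proof -
  let ?\<F> = "{F. finite F \<and> F \<noteq> {}}"
  have ne: "{undefined} \<in> ?\<F>" by simp
  have above: "bdd_above (range (\<lambda>x. orbit_avg act A F x))" if "F \<in> ?\<F>" for F
    using that orbit_avg_bounds[of F act A] by (intro bdd_aboveI2[where M=1]) auto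
  have below: "bdd_below (range (\<lambda>x. orbit_avg act B F x))" if "F \<in> ?\<F>" for F
    using that orbit_avg_bounds[of F act B] by (intro bdd_belowI2[where m=0]) auto
  have "\<exists>F\<in>?\<F>. (SUP x. orbit_avg act A F x) < lower_density act B"
  proof -
    have "bdd_below ((\<lambda>F. SUP x. orbit_avg act A F x) ` ?\<F>)"
    proof (rule bdd_belowI2[where m=0])
      fix F :: "'a set" assume F: "F \<in> ?\<F>"
      show "0 \<le> (SUP x. orbit_avg act A F x)"
        using F orbit_avg_bounds[of F act A] by (intro cSUP_upper2[OF above[OF F], of undefined]) auto
    qed
    then show ?thesis
      using assms ne unfolding upper_density_def by (subst (asm) cINF_less_iff) auto
  qed
  then obtain F where F: "F \<in> ?\<F>" "(SUP x. orbit_avg act A F x) < lower_density act B"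
    by blast
  have "\<exists>F'\<in>?\<F>. (SUP x. orbit_avg act A F x) < (INF x. orbit_avg act B F' x)"
  proof -
    have "bdd_above ((\<lambda>F. INF x. orbit_avg act B F x) ` ?\<F>)"
    proof (rule bdd_aboveI2[where M=1])
      fix F :: "'a set" assume F: "F \<in> ?\<F>"
      show "(INF x. orbit_avg act B F x) \<le> 1"
        using F orbit_avg_bounds[of F act B] by (intro cINF_lower2[OF below[OF F], of undefined]) auto
    qed
    then show ?thesis
      using F(2) ne unfolding lower_density_def by (subst (asm) less_cSUP_iff) auto
  qed
  then obtain F' where F': "F' \<in> ?\<F>"
      "(SUP x. orbit_avg act A F x) < (INF x. orbit_avg act B F' x)"
    by blast
  show thesis
    using F(1) F' cSUP_upper[OF _ above[OF F(1)]] cINF_lower[OF below[OF F'(1)]]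
    by (intro that[of F F' "SUP x. orbit_avg act A F x" "INF x. orbit_avg act B F' x"]) auto
qed

text \<open>A closed \<open>B'\<close> inside \<open>B\<close> admits a continuous function that is
  1 on \<open>B'\<close> and 0 off \<open>B\<close>. The visits of \<open>x\<close> to
  \<open>B\<close> persist on a small closed ball around \<open>x\<close>; finitely many such balls
  cover the space, and \<open>B'\<close> collects their images.\<close>

lemma closed_subset_same_average:
  fixes act :: "'g::group_add \<Rightarrow> 'x::metric_space \<Rightarrow> 'x"
  assumes "compact (UNIV :: 'x set)" "continuous_action act" "open B" "finite F"
    and "\<And>x. \<gamma> \<le> orbit_avg act B F x"
  obtains B' where "closed B'" "B' \<subseteq> B" "\<And>x. \<gamma> \<le> orbit_avg act B' F x"
proof -
  have cont: "continuous_on X (act g)" for g X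
    using assms(2) unfolding continuous_action_def by (auto intro: continuous_on_subset)
  define T where "T x = {s \<in> F. act s x \<in> B}" for x
  have "\<exists>e>0. \<forall>s\<in>T x. act s ` cball x e \<subseteq> B" for x
  proof -
    have "open (\<Inter>s\<in>T x. act s -` B)"
      using assms(3,4) cont by (auto simp: T_def intro!: open_vimage)
    moreover have "x \<in> (\<Inter>s\<in>T x. act s -` B)" by (auto simp: T_def)
    ultimately obtain e where "e > 0" "cball x e \<subseteq> (\<Inter>s\<in>T x. act s -` B)"
      using open_contains_cball by metis
    then show ?thesis by blast
  qed
  then obtain e where e: "\<And>x. e x > 0" "\<And>x s. s \<in> T x \<Longrightarrow> act s ` cball x (e x) \<subseteq> B"
    by metis
  obtain D where D: "finite D" "(UNIV :: 'x set) \<subseteq> (\<Union>x\<in>D. ball x (e x))"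
  proof (rule compactE_image[OF assms(1), of UNIV "\<lambda>x. ball x (e x)"])
    show "(UNIV :: 'x set) \<subseteq> (\<Union>x\<in>UNIV. ball x (e x))"
      using e(1) centre_in_ball by blast
  qed (auto simp: e(1))
  define B' where "B' = (\<Union>x\<in>D. \<Union>s\<in>T x. act s ` cball x (e x))"
  have "compact (cball x (e x))" for x
    using assms(1) compact_Int_closed[of UNIV "cball x (e x)"] by simp
  then have "compact (act s ` cball x (e x))" for s x
    using cont compact_continuous_image by blast
  then have "closed B'"
    unfolding B'_def using D(1) assms(4)
    by (intro closed_UN ballI) (auto simp: T_def compact_imp_closed)
  moreover have "B' \<subseteq> B" using e(2) by (auto simp: B'_def)
  moreover have "\<gamma> \<le> orbit_avg act B' F y" for y
  proof -
    obtain x where x: "x \<in> D" "y \<in> ball x (e x)" using D(2) by blast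
    then have "y \<in> cball x (e x)" by auto
    \<comment> \<open>The visits of \<open>y\<close> to \<open>B'\<close> are compared with the
      visits to \<open>B\<close> of the centre \<open>x\<close>, whose average is already at least
      \<gamma>.\<close>
    then have "T x \<subseteq> {s \<in> F. act s y \<in> B'}"
      using x(1) unfolding B'_def by (auto simp: T_def intro!: bexI[of _ x] image_eqI[of _ _ y])
    then have "card (T x) \<le> card {s \<in> F. act s y \<in> B'}"
      using assms(4) by (intro card_mono) auto
    then have "orbit_avg act B F x \<le> orbit_avg act B' F y"
      by (simp add: orbit_avg_eq_card[OF assms(4)] T_def divide_right_mono)
    then show ?thesis using assms(5)[of x] by linarith
  qed
  ultimately show thesis by (rule that)
qed

subsection \<open>Orbit balls\<close>

definition orbit_ball :: "('g::group_add \<Rightarrow> 'x \<Rightarrow> 'x) \<Rightarrow> 'g set \<Rightarrow> nat \<Rightarrow> 'x \<Rightarrow> 'x set" where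
  "orbit_ball act S n x = (\<lambda>g. act g x) ` word_ball S n"

lemma finite_orbit_ball: "finite S \<Longrightarrow> finite (orbit_ball act S n x)"
  unfolding orbit_ball_def by (simp add: finite_word_ball)

lemma card_orbit_ball_pos: "finite S \<Longrightarrow> 1 \<le> card (orbit_ball act S n x)"
  using finite_orbit_ball[of S act n x] zero_in_word_ball[of S n]
  by (auto simp: Suc_le_eq card_gt_0_iff orbit_ball_def)

lemma act_in_orbit_ball:
  assumes "group_action act" "g \<in> word_ball S r" "y \<in> orbit_ball act S n x"
  shows "act g y \<in> orbit_ball act S (r + n) x"
proof -
  obtain h where "h \<in> word_ball S n" "y = act h x"
    using assms(3) unfolding orbit_ball_def by blast
  then have "act g y = act (g + h) x" "g + h \<in> word_ball S (r + n)"
    using assms(1) word_ball_add[OF assms(2)] by (simp_all add: group_action_def)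
  then show ?thesis unfolding orbit_ball_def by blast
qed

lemma group_action_inj: "group_action act \<Longrightarrow> inj (act g)"
  unfolding group_action_def by (metis add.left_inverse injI)

section \<open>Double counting in orbit balls\<close>

lemma sum_card_incidence:
  assumes "finite F" "finite O'"
  shows "(\<Sum>z\<in>O'. card {s \<in> F. act s z \<in> A}) = (\<Sum>s\<in>F. card {z \<in> O'. act s z \<in> A})"
  by (rule sum_multicount_gen) (use assms in auto)

text \<open>Count pairs \<open>(s, z)\<close> with \<open>act s z\<close> in \<open>A\<close>. For
  every \<open>s\<close> in \<open>F\<close>, each point of \<open>A\<close> in the ball of radius
  \<open>n\<close> is hit from a point of the ball of radius \<open>n + r\<close>. Counting orbit
  points instead of group elements accommodates stabilizers.\<close>

lemma card_orbit_ball_Int_le: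
  assumes "finite_symmetric_generating_set S" "group_action act" "finite F" "F \<noteq> {}"
    and "F \<subseteq> word_ball S r" and avg: "\<And>x. orbit_avg act A F x \<le> \<alpha>"
  shows "real (card (orbit_ball act S n x \<inter> A)) \<le> \<alpha> * real (card (orbit_ball act S (n + r) x))"
proof -
  let ?O = "orbit_ball act S (n + r) x"
  have S: "finite S" "\<And>s. s \<in> S \<Longrightarrow> - s \<in> S"
    using assms(1) unfolding finite_symmetric_generating_set_def by auto
  have F: "0 < card F" using assms(3,4) by (simp add: card_gt_0_iff)
  have fin: "finite ?O" using S(1) by (rule finite_orbit_ball)
  have "card (orbit_ball act S n x \<inter> A) \<le> card {z \<in> ?O. act s z \<in> A}" if "s \<in> F" for s
  proof (rule surj_card_le)
    show "orbit_ball act S n x \<inter> A \<subseteq> act s ` {z \<in> ?O. act s z \<in> A}"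
    proof
      fix y assume y: "y \<in> orbit_ball act S n x \<inter> A"
      have "act s (act (- s) y) = y"
        using assms(2) unfolding group_action_def by (metis add.right_inverse)
      moreover have "act (- s) y \<in> ?O"
        using act_in_orbit_ball[OF assms(2) word_ball_uminus[OF S(2)], of s r y n x] assms(5) that y
        by (auto simp: add.commute)
      ultimately show "y \<in> act s ` {z \<in> ?O. act s z \<in> A}"
        using y by (intro image_eqI[of _ _ "act (- s) y"]) auto
    qed
  qed (simp add: fin)
  then have "card F * card (orbit_ball act S n x \<inter> A) \<le> (\<Sum>s\<in>F. card {z \<in> ?O. act s z \<in> A})"
    using sum_mono[of F "\<lambda>_. card (orbit_ball act S n x \<inter> A)"] by simp
  also have "\<dots> = (\<Sum>z\<in>?O. card {s \<in> F. act s z \<in> A})"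
    by (rule sum_card_incidence[OF assms(3) fin, symmetric])
  finally have "real (card F * card (orbit_ball act S n x \<inter> A))
      \<le> real (\<Sum>z\<in>?O. card {s \<in> F. act s z \<in> A})" by (rule of_nat_mono)
  also have "\<dots> \<le> (\<Sum>z\<in>?O. \<alpha> * real (card F))"
    unfolding of_nat_sum using avg F
    by (intro sum_mono) (simp add: orbit_avg_eq_card[OF assms(3)] divide_le_eq)
  finally show ?thesis using F by (simp add: ac_simps)
qed

text \<open>The same double count with the margin on the other side: each \<open>s\<close> in
  \<open>F\<close> maps the ball of radius \<open>n\<close> injectively into that of radius
  \<open>n + r\<close>.\<close>

lemma card_orbit_ball_Int_ge:
  assumes "finite S" "group_action act" "finite F" "F \<noteq> {}"
    and "F \<subseteq> word_ball S r" and avg: "\<And>x. \<gamma> \<le> orbit_avg act B F x"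
  shows "\<gamma> * real (card (orbit_ball act S n x)) \<le> real (card (orbit_ball act S (n + r) x \<inter> B))"
proof -
  let ?O = "orbit_ball act S n x"
  have F: "0 < card F" using assms(3,4) by (simp add: card_gt_0_iff)
  have fin: "finite (orbit_ball act S n x)" for n using assms(1) by (rule finite_orbit_ball)
  have "(\<Sum>z\<in>?O. \<gamma> * real (card F)) \<le> real (\<Sum>z\<in>?O. card {s \<in> F. act s z \<in> B})"
    unfolding of_nat_sum using avg F
    by (intro sum_mono) (simp add: orbit_avg_eq_card[OF assms(3)] le_divide_eq)
  also have "(\<Sum>z\<in>?O. card {s \<in> F. act s z \<in> B}) = (\<Sum>s\<in>F. card {z \<in> ?O. act s z \<in> B})"
    by (rule sum_card_incidence[OF assms(3) fin])
  also have "real \<dots> \<le> real (\<Sum>s\<in>F. card (orbit_ball act S (n + r) x \<inter> B))"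
  proof (intro of_nat_mono sum_mono card_inj_on_le)
    fix s assume "s \<in> F"
    show "inj_on (act s) {z \<in> ?O. act s z \<in> B}"
      using group_action_inj[OF assms(2)] by (rule inj_on_subset) simp
    show "act s ` {z \<in> ?O. act s z \<in> B} \<subseteq> orbit_ball act S (n + r) x \<inter> B"
      using act_in_orbit_ball[OF assms(2)] \<open>s \<in> F\<close> assms(5) by (fastforce simp: add.commute)
  qed (simp add: fin)
  finally show ?thesis using F by (simp add: ac_simps)
qed

text \<open>The radii satisfy m (i+1) = 2 * m i + t, so a failure at every i < I would
  force growth by a factor 2^d + 1 per doubling.\<close>

lemma uniform_doubling_scale:
  fixes C :: real and d t :: nat
  defines "m \<equiv> \<lambda>i::nat. 2 ^ i * (1 + t) - t"
  shows "\<exists>I. \<forall>f :: nat \<Rightarrow> nat. (\<forall>n\<ge>1. real (f n) \<le> C * real n ^ d) \<longrightarrow> (\<forall>n. 1 \<le> f n) \<longrightarrow>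
    (\<exists>i<I. f (2 * m i + t) \<le> (2 ^ d + 1) * f (m i))"
proof -
  have ge: "1 + t \<le> 2 ^ i * (1 + t)" for i
    using mult_le_mono1[of 1 "2 ^ i" "1 + t"] by simp
  have m_Suc: "m (Suc i) = 2 * m i + t" for i
    using ge[of i] unfolding m_def by (simp add: diff_mult_distrib2)
  \<comment> \<open>\<open>q ^ I\<close> compares the forced growth \<open>(2 ^ d + 1) ^ I\<close>
    with the growth \<open>(2 ^ d) ^ I\<close> that degree \<open>d\<close> allows up to a constant.
    \<open>I\<close> is fixed before \<open>f\<close>, which makes the bound uniform over all
    orbits.\<close>
  define q :: real where "q = (2 ^ d + 1) / 2 ^ d"
  have "1 < q" by (simp add: q_def)
  then obtain I where I: "C * real (1 + t) ^ d < q ^ I"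
    using real_arch_pow by blast
  show ?thesis
  proof (rule exI[of _ I], intro allI impI, rule ccontr)
    fix f :: "nat \<Rightarrow> nat"
    assume f: "\<forall>n\<ge>1. real (f n) \<le> C * real n ^ d" "\<forall>n. 1 \<le> f n"
      and "\<not> (\<exists>i<I. f (2 * m i + t) \<le> (2 ^ d + 1) * f (m i))"
    then have step: "(2 ^ d + 1) * f (m i) \<le> f (m (Suc i))" if "i < I" for i
      using that by (auto simp: m_Suc not_le less_imp_le)
    have "(2 ^ d + 1) ^ i \<le> f (m i)" if "i \<le> I" for i
      using that
    proof (induction i)
      case (Suc i)
      then have "(2 ^ d + 1) * (2 ^ d + 1) ^ i \<le> (2 ^ d + 1) * f (m i)"
        by (intro mult_left_mono) auto
      then show ?case using step[of i] Suc.prems by simp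
    qed (use f in simp)
    then have "real ((2 ^ d + 1) ^ I) \<le> real (f (m I))"
      by (intro of_nat_mono) simp
    also have m1: "1 \<le> m I" using ge[of I] by (simp add: m_def)
    then have "real (f (m I)) \<le> C * real (m I) ^ d" using f by simp
    also have "0 \<le> C"
      using f(1)[rule_format, of 1] f(2)[rule_format, of 1] by simp
    then have "C * real (m I) ^ d \<le> C * real (2 ^ I * (1 + t)) ^ d"
      by (intro mult_left_mono power_mono of_nat_mono) (simp_all add: m_def)
    also have "\<dots> = C * real (1 + t) ^ d * (2 ^ d) ^ I"
      by (simp only: of_nat_mult of_nat_power power_mult_distrib)
        (simp add: mult.commute flip: power_mult)
    also have "\<dots> < q ^ I * (2 ^ d) ^ I"
      using I by (intro mult_strict_right_mono) auto
    also have "\<dots> = real ((2 ^ d + 1) ^ I)"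
      by (simp add: q_def add.commute flip: power_mult_distrib)
    finally show False by simp
  qed
qed

subsection \<open>The cover\<close>

text \<open>List \<open>E 0\<close>, then \<open>E 1\<close>, and so on, allowing repetitions. By
  monotonicity, all entries up to the end of stage \<open>i\<close> lie in
  \<open>E i\<close>.\<close>

lemma staged_enumeration:
  fixes E :: "nat \<Rightarrow> 'a set"
  assumes "\<And>i. finite (E i)" "mono E"
  shows "\<exists>l. set l \<subseteq> (\<Union>i<I. E i) \<and>
    (\<forall>i<I. \<forall>p\<in>E i. \<exists>k<length l. l ! k = p \<and> (\<forall>j\<le>k. l ! j \<in> E i))"
proof (induction I)
  case (Suc I)
  then obtain l where l: "set l \<subseteq> (\<Union>i<I. E i)"
    "\<And>i p. i < I \<Longrightarrow> p \<in> E i \<Longrightarrow> \<exists>k<length l. l ! k = p \<and> (\<forall>j\<le>k. l ! j \<in> E i)" by blast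
  obtain l' where l': "set l' = E I" using assms(1) finite_list by blast
  have sub: "set (l @ l') \<subseteq> E I"
  proof -
    have "E i \<subseteq> E I" if "i < I" for i using that monoD[OF assms(2)] by simp
    then show ?thesis using l(1) l' by fastforce
  qed
  have "\<exists>k<length (l @ l'). (l @ l') ! k = p \<and> (\<forall>j\<le>k. (l @ l') ! j \<in> E i)"
    if i: "i < Suc I" and p: "p \<in> E i" for i p
  proof (cases "i < I")
    case True
    then obtain k where "k < length l" "l ! k = p" "\<forall>j\<le>k. l ! j \<in> E i" using l(2)[OF True p] by blast
    then show ?thesis by (intro exI[of _ k]) (auto simp: nth_append)
  next
    case False
    then have "i = I" using i by simp
    then have "p \<in> set (l @ l')" using p l' by simp
    then obtain k where "k < length (l @ l')" "(l @ l') ! k = p" by (auto simp only: in_set_conv_nth)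
    then show ?thesis
      using sub nth_mem[of _ "l @ l'"] \<open>i = I\<close> by (metis le_less_trans subsetD)
  qed
  moreover have "set (l @ l') \<subseteq> (\<Union>i<Suc I. E i)" using l(1) l' by (simp add: lessThan_Suc) blast
  ultimately show ?case by (intro exI[of _ "l @ l'"]) blast
qed simp

lemma Urysohn_metric:
  fixes K L :: "'x::metric_space set"
  assumes "closed K" "closed L" "K \<inter> L = {}"
  obtains f :: "'x \<Rightarrow> real" where "continuous_on UNIV f"
    "\<And>x. x \<in> K \<Longrightarrow> f x = 0" "\<And>x. x \<in> L \<Longrightarrow> f x = 1"
proof -
  have "normal_space (euclidean :: 'x topology)"
    by (simp add: metrizable_imp_normal_space metrizable_space_euclidean)
  then obtain f where "continuous_map euclidean (top_of_set {0..1}) f" "f ` K \<subseteq> {0}" "f ` L \<subseteq> {1::real}"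
    by (rule Urysohn_lemma[of _ K L 0 1]) (use assms in \<open>auto simp: disjnt_def\<close>)
  then show thesis
    by (intro that[of f]) (auto simp: continuous_map_in_subtopology)
qed

text \<open>Enumerating the steps by increasing radius ensures that a slot within radius n i of x
  is blocked only from within radius n i of the slot, even if n i is unsuitable for other
  points.\<close>

lemma greedy_cover:
  fixes act :: "'g::group_add \<Rightarrow> 'x::metric_space \<Rightarrow> 'x" and n :: "nat \<Rightarrow> nat"
  assumes S: "finite_symmetric_generating_set S" and act: "continuous_action act"
    and A: "open A" and B: "open B" and C: "closed C" "C \<subseteq> A" and B': "closed B'" "B' \<subseteq> B"
    and radii: "mono n" and good: "\<And>x. \<exists>i<I.
      card (orbit_ball act S (2 * n i) x \<inter> A) < (K + 1) * card (orbit_ball act S (n i) x \<inter> B')"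
  obtains \<U> s idx where "finite \<U>" "\<And>U. U \<in> \<U> \<Longrightarrow> open U" "C \<subseteq> \<Union>\<U>"
    "\<And>U. U \<in> \<U> \<Longrightarrow> idx U \<le> K" "\<And>U. U \<in> \<U> \<Longrightarrow> act (s U) ` U \<subseteq> B"
    "\<And>U V. U \<in> \<U> \<Longrightarrow> V \<in> \<U> \<Longrightarrow> U \<noteq> V \<Longrightarrow> idx U = idx V \<Longrightarrow>
       act (s U) ` U \<inter> act (s V) ` V = {}"
proof -
  have fS: "finite S" and uS: "\<And>s. s \<in> S \<Longrightarrow> - s \<in> S"
    using S by (auto simp: finite_symmetric_generating_set_def)
  have ga: "group_action act" using act by (simp add: continuous_action_def)
  define E where "E i = {..K} \<times> word_ball S (n i)" for i
  have "mono E"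
    using word_ball_mono[OF monoD[OF radii]] unfolding E_def by (intro monoI Sigma_mono) auto
  moreover have "finite (E i)" for i
    using finite_word_ball[OF fS] by (simp add: E_def)
  ultimately obtain l where l: "set l \<subseteq> (\<Union>i<I. E i)"
    "\<And>i p. i < I \<Longrightarrow> p \<in> E i \<Longrightarrow> \<exists>k<length l. l ! k = p \<and> (\<forall>j\<le>k. l ! j \<in> E i)"
    using staged_enumeration[of E I] by blast
  define s col where "s k = snd (l ! k)" and "col k = fst (l ! k)" for k
  obtain m\<^sub>0 :: "'x \<Rightarrow> real" where m\<^sub>0: "continuous_on UNIV m\<^sub>0"
      "\<And>x. x \<in> C \<Longrightarrow> m\<^sub>0 x = 0" "\<And>x. x \<in> - A \<Longrightarrow> m\<^sub>0 x = 1"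
    using Urysohn_metric[of C "- A"] C A by (metis Diff_eq Diff_eq_empty_iff closed_Compl)
  \<comment> \<open>The previous function leaves points of \<open>C\<close> unloaded and bars points
    outside \<open>A\<close> from claiming; this one opens the slots over \<open>B'\<close> fully
    and closes those outside \<open>B\<close>.\<close>
  obtain b :: "'x \<Rightarrow> real" where b: "continuous_on UNIV b"
      "\<And>x. x \<in> - B \<Longrightarrow> b x = 0" "\<And>x. x \<in> B' \<Longrightarrow> b x = 1"
    using Urysohn_metric[of "- B" B'] B' B
    by (metis Diff_eq Diff_eq_empty_iff closed_Compl inf_commute)
  interpret greedy_matching act s col m\<^sub>0 b by unfold_locales (rule ga)
  define W where "W k = {x. 1/2 < claim k x}" for k
  \<comment> \<open>Different steps may give the same set, for instance the empty one, whereas shift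
    and colour must be functions of the set. Hence one step is selected for each member of the
    cover.\<close>
  define ix where "ix U = (SOME k. k < length l \<and> W k = U)" for U
  define \<U> where "\<U> = W ` {..<length l}"
  have ix: "ix U < length l" "W (ix U) = U" if "U \<in> \<U>" for U
  proof -
    have "\<exists>k. k < length l \<and> W k = U" using that by (auto simp: \<U>_def)
    from someI_ex[OF this] show "ix U < length l" "W (ix U) = U" by (auto simp: ix_def)
  qed
  have cover: "\<exists>k<length l. x \<in> W k" if x: "x \<in> C" for x
  proof (rule ccontr)
    assume uncovered: "\<not> (\<exists>k<length l. x \<in> W k)"
    have unclaimed: "claim k x \<le> 1/2" if "k < length l" for k
    proof -
      have "x \<notin> W k" using uncovered that by blast
      then show ?thesis by (simp add: W_def not_less)
    qed
    obtain i where i: "i < I"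
      "card (orbit_ball act S (2 * n i) x \<inter> A) < (K + 1) * card (orbit_ball act S (n i) x \<inter> B')"
      using good by blast
    \<comment> \<open>These are the slots within reach of \<open>x\<close>, one for each colour and
      each point of \<open>B'\<close>. If \<open>x\<close> is uncovered, all are blocked, and their
      distinct owners are too many for the choice of \<open>i\<close>.\<close>
    let ?T = "{..K} \<times> (orbit_ball act S (n i) x \<inter> B')"
    have "card ?T \<le> card (orbit_ball act S (2 * n i) x \<inter> A)"
    proof (rule card_blocked_slots_le)
      fix c y assume T: "(c, y) \<in> ?T"
      then show "3/4 < b y" using b(3) by auto
      obtain g where g: "g \<in> word_ball S (n i)" "y = act g x"
        using T by (auto simp: orbit_ball_def)
      then have "(c, g) \<in> E i" using T by (auto simp: E_def)
      from l(2)[OF i(1) this] obtain k where k: "k < length l" "l ! k = (c, g)" "\<forall>j\<le>k. l ! j \<in> E i"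
        by blast
      have "\<exists>j<k. col j = col k \<and> 1/4 \<le> claim j (act (- s j) (act (s k) x))"
      proof (rule unclaimed_imp_blocked)
        show "m\<^sub>0 x \<le> 1/2" using m\<^sub>0(2) x by simp
        show "claim j x \<le> 1/2" if "j \<le> k" for j using unclaimed that k(1) by simp
        show "3/4 < b (act (s k) x)" using \<open>3/4 < b y\<close> g k(2) by (simp add: s_def)
      qed
      then obtain j where j: "j < k" "col j = c" "1/4 \<le> claim j (act (- s j) y)"
        using k(2) g by (auto simp: s_def col_def)
      have "act (- s j') y \<in> orbit_ball act S (2 * n i) x \<inter> A"
        if "j' \<le> j" "m\<^sub>0 (act (- s j') y) < 1" for j'
      proof -
        have "l ! j' \<in> E i" using k(3) that(1) j(1) by simp
        then have "s j' \<in> word_ball S (n i)" by (auto simp: E_def s_def)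
        then have "- s j' \<in> word_ball S (n i)" by (intro word_ball_uminus uS)
        then have "act (- s j') y \<in> orbit_ball act S (n i + n i) x"
          using T by (intro act_in_orbit_ball[OF ga]) auto
        moreover have "act (- s j') y \<in> A" using m\<^sub>0(3) that(2) by force
        ultimately show ?thesis by (simp add: mult_2)
      qed
      then show "\<exists>k. col k = c \<and> 1/4 \<le> claim k (act (- s k) y) \<and>
          (\<forall>j\<le>k. m\<^sub>0 (act (- s j) y) < 1 \<longrightarrow>
            act (- s j) y \<in> orbit_ball act S (2 * n i) x \<inter> A)"
        using j by blast
    qed (simp add: finite_orbit_ball[OF fS])
    then show False using i(2) by (simp add: card_cartesian_product)
  qed
  show thesis
  proof (rule that[of \<U> "\<lambda>U. col (ix U)" "\<lambda>U. s (ix U)"])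
    show "finite \<U>" by (simp add: \<U>_def)
    show "C \<subseteq> \<Union>\<U>" using cover by (auto simp: \<U>_def)
  next
    fix U assume U: "U \<in> \<U>"
    have "open (W k)" for k
      unfolding W_def using continuous_claim[OF act m\<^sub>0(1) b(1)]
      by (intro open_Collect_less) auto
    then show "open U" using ix(2)[OF U] by metis
    have "l ! ix U \<in> (\<Union>i<I. E i)" using l(1) ix(1)[OF U] nth_mem by blast
    then show "col (ix U) \<le> K" by (auto simp: E_def col_def)
    show "act (s (ix U)) ` U \<subseteq> B"
    proof
      fix y assume "y \<in> act (s (ix U)) ` U"
      then obtain x where "x \<in> W (ix U)" "y = act (s (ix U)) x" using ix(2)[OF U] by auto
      then have "1/2 < b y" using claimed_target by (simp add: W_def)
      then show "y \<in> B" using b(2)[of y] by force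
    qed
  next
    fix U V assume UV: "U \<in> \<U>" "V \<in> \<U>" "U \<noteq> V" "col (ix U) = col (ix V)"
    then have "ix U \<noteq> ix V" using ix(2) by metis
    then show "act (s (ix U)) ` U \<inter> act (s (ix V)) ` V = {}"
      using claimed_targets_disjoint[OF _ UV(4)] ix(2) UV(1,2) by (simp add: W_def)
  qed
qed

theorem mainTheorem5:
  fixes S :: "'g::group_add set"
    and act :: "'g \<Rightarrow> 'x::metric_space \<Rightarrow> 'x"
    and d :: nat and C :: real
  assumes "finite_symmetric_generating_set S"
    and "C > 0"
    and "\<forall>n\<ge>1. real (card (word_ball S n)) \<le> C * real n ^ d"
    and "compact (UNIV :: 'x set)"
    and "continuous_action act"
  shows "\<forall>A B. open A \<and> open B \<and> upper_density act A < lower_density act B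
            \<longrightarrow> subequiv act (2 ^ d) A B"
proof (intro allI impI)
  fix A B :: "'x set"
  assume "open A \<and> open B \<and> upper_density act A < lower_density act B"
  then have AB: "open A" "open B" and dens: "upper_density act A < lower_density act B" by auto
  have fS: "finite S" using assms(1) by (simp add: finite_symmetric_generating_set_def)
  have ga: "group_action act" using assms(5) by (simp add: continuous_action_def)
  obtain F F' \<alpha> \<gamma> where F: "finite F" "F \<noteq> {}" "finite F'" "F' \<noteq> {}" "\<alpha> < \<gamma>"
    "\<And>x. orbit_avg act A F x \<le> \<alpha>" "\<And>x. \<gamma> \<le> orbit_avg act B F' x"
    using density_separation[OF dens] by blast
  obtain B' where B': "closed B'" "B' \<subseteq> B" "\<And>x. \<gamma> \<le> orbit_avg act B' F' x"
    using closed_subset_same_average[OF assms(4,5) AB(2) F(3) F(7)] by blast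
  obtain r where "F \<union> F' \<subseteq> word_ball S r"
    using finite_subset_word_ball[OF assms(1), of "F \<union> F'"] F(1,3) by auto
  then have r: "F \<subseteq> word_ball S r" "F' \<subseteq> word_ball S r" by auto
  \<comment> \<open>\<open>B'\<close> is counted at radius \<open>m i + r\<close>. Doubling this
    radius and adding the margin \<open>r\<close> for counting \<open>A\<close> gives
    \<open>2 * m i + 3 * r\<close>, hence the constant \<open>3 * r\<close>.\<close>
  define m where "m i = 2 ^ i * (1 + 3 * r) - 3 * r" for i :: nat
  obtain I where I: "\<And>f :: nat \<Rightarrow> nat. (\<forall>n\<ge>1. real (f n) \<le> C * real n ^ d) \<Longrightarrow>
      (\<forall>n. 1 \<le> f n) \<Longrightarrow> \<exists>i<I. f (2 * m i + 3 * r) \<le> (2 ^ d + 1) * f (m i)"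
    using uniform_doubling_scale[where C=C and d=d and t="3 * r"] unfolding m_def by blast
  have "mono (\<lambda>i. m i + r)"
    unfolding m_def by (intro monoI add_right_mono diff_le_mono mult_le_mono1 power_increasing) auto
  moreover have "\<exists>i<I. card (orbit_ball act S (2 * (m i + r)) x \<inter> A)
      < (2 ^ d + 1) * card (orbit_ball act S (m i + r) x \<inter> B')" for x
  proof -
    let ?f = "\<lambda>n. card (orbit_ball act S n x)"
    have "\<forall>n\<ge>1. real (?f n) \<le> C * real n ^ d"
      using assms(3) card_image_le[OF finite_word_ball[OF fS], of "\<lambda>g. act g x"]
      unfolding orbit_ball_def by (meson of_nat_mono order.trans)
    moreover have "\<forall>n. 1 \<le> ?f n" using card_orbit_ball_pos[OF fS] by (intro allI)
    ultimately obtain i where i: "i < I" "?f (2 * m i + 3 * r) \<le> (2 ^ d + 1) * ?f (m i)"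
      using I[of ?f] by blast
    have "0 \<le> \<alpha>" using F(6)[of x] orbit_avg_bounds[OF F(1), of act A x] by linarith
    have "real (card (orbit_ball act S (2 * (m i + r)) x \<inter> A))
        \<le> \<alpha> * real (?f (2 * (m i + r) + r))"
      by (rule card_orbit_ball_Int_le[OF assms(1) ga F(1,2) r(1) F(6)])
    also have "2 * (m i + r) + r = 2 * m i + 3 * r" by simp
    also have "\<alpha> * real (?f (2 * m i + 3 * r)) \<le> \<alpha> * real ((2 ^ d + 1) * ?f (m i))"
      using \<open>0 \<le> \<alpha>\<close> i(2) by (intro mult_left_mono of_nat_mono)
    \<comment> \<open>Orbit balls are nonempty, so the gap between \<alpha> and \<gamma> makes the
      comparison strict.\<close>
    also have "0 < (2 ^ d + 1) * ?f (m i)"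
      using card_orbit_ball_pos[OF fS, of act "m i" x] by simp
    then have "\<alpha> * real ((2 ^ d + 1) * ?f (m i)) < \<gamma> * real ((2 ^ d + 1) * ?f (m i))"
      using F(5) by (intro mult_strict_right_mono) (simp_all only: of_nat_0_less_iff)
    also have "\<dots> = (2 ^ d + 1) * (\<gamma> * real (?f (m i)))"
      by (simp add: algebra_simps)
    also have "\<dots> \<le> (2 ^ d + 1) * real (card (orbit_ball act S (m i + r) x \<inter> B'))"
      using card_orbit_ball_Int_ge[OF fS ga F(3,4) r(2) B'(3)] by (intro mult_left_mono) auto
    also have "\<dots> = real ((2 ^ d + 1) * card (orbit_ball act S (m i + r) x \<inter> B'))"
      by (simp add: algebra_simps)
    finally have "card (orbit_ball act S (2 * (m i + r)) x \<inter> A)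
        < (2 ^ d + 1) * card (orbit_ball act S (m i + r) x \<inter> B')"
      by (simp only: of_nat_less_iff)
    with i(1) show ?thesis by (intro exI[of _ i] conjI)
  qed
  ultimately have cover: "\<exists>\<U> s (idx :: 'x set \<Rightarrow> nat).
      finite \<U> \<and> (\<forall>U\<in>\<U>. open U) \<and> D \<subseteq> \<Union>\<U> \<and>
      (\<forall>U\<in>\<U>. idx U \<le> 2 ^ d) \<and> (\<forall>U\<in>\<U>. act (s U) ` U \<subseteq> B) \<and>
      (\<forall>U\<in>\<U>. \<forall>V\<in>\<U>. U \<noteq> V \<and> idx U = idx V \<longrightarrow> act (s U) ` U \<inter> act (s V) ` V = {})"
    if D: "closed D" "D \<subseteq> A" for D
  proof (rule greedy_cover[OF assms(1,5) AB D B'(1,2)])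
    fix \<U> s and idx :: "'x set \<Rightarrow> nat"
    assume \<U>: "finite \<U>" "\<And>U. U \<in> \<U> \<Longrightarrow> open U" "D \<subseteq> \<Union>\<U>"
      "\<And>U. U \<in> \<U> \<Longrightarrow> idx U \<le> 2 ^ d" "\<And>U. U \<in> \<U> \<Longrightarrow> act (s U) ` U \<subseteq> B"
      "\<And>U V. U \<in> \<U> \<Longrightarrow> V \<in> \<U> \<Longrightarrow> U \<noteq> V \<Longrightarrow> idx U = idx V \<Longrightarrow>
         act (s U) ` U \<inter> act (s V) ` V = {}"
    show ?thesis
      by (rule exI[of _ \<U>], rule exI[of _ s], rule exI[of _ idx])
        (intro conjI ballI impI \<U>; blast)
  qed
  show "subequiv act (2 ^ d) A B"
    unfolding subequiv_def by (intro allI impI cover) simp_all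
qed

end
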